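(* Let $\lambda>0$ and let $S$ and $S'$ be two independent network random walks on $\Gamma_1(\lambda)$ with arbitrary starting points $S_0$ and $S_0'$. Then $S-S'=(S_n-S_n')_{n\ge0}$ is a recurrent random walk; in particular, almost surely, there are infinitely many $n$ for which $S_n-S_n'=S_0-S_0'$. Thus, if $S$ and $S'$ start at the same point, then almost surely $S_n=S_n'$ for infinitely many $n$.
   Context: $\Gamma_1(\lambda)$ is the nearest-neighbour lattice graph on $\mathbb{Z}^{2}=\mathbb{Z}\times\mathbb{Z}$ with conductance $\mu((n,x),(n',x'))=e^{\lambda\max(n,n')}$ on each edge $(n,x)\sim(n',x')$. The network random walk is the Markov chain which jumps to a neighbour with probability proportional to the conductance of the connecting edge; equivalently, its i.i.d. steps equal $(1,0)$ with probability $e^\lambda/(3+e^\lambda)$ and each of $(-1,0),(0,1),(0,-1)$ with probability $1/(3+e^\lambda)$. *)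

theory Defs
  imports "HOL-Probability.Probability"
begin

definition lattice_adj :: "int \<times> int \<Rightarrow> int \<times> int \<Rightarrow> bool" where
  "lattice_adj u v \<longleftrightarrow> \<bar>fst u - fst v\<bar> + \<bar>snd u - snd v\<bar> = 1"

definition Gamma1_conductance :: "real \<Rightarrow> int \<times> int \<Rightarrow> int \<times> int \<Rightarrow> real" where
  "Gamma1_conductance lam u v = exp (lam * real_of_int (max (fst u) (fst v)))"

(* E is the adjacency relation of a locally finite graph; the values of c off the edges are
   irrelevant. *)
definition jump_prob :: "('v \<Rightarrow> 'v \<Rightarrow> bool) \<Rightarrow> ('v \<Rightarrow> 'v \<Rightarrow> real) \<Rightarrow> 'v \<Rightarrow> 'v \<Rightarrow> real" where
  "jump_prob E c u v = (if E u v then c u v / (\<Sum>w | E u w. c u w) else 0)"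

(* The initial law is unrestricted; a deterministic starting point is a special case. The Markov
   property is stated through cylinder probabilities, so nothing is conditioned on a null event. *)
definition network_walk ::
  "'a measure \<Rightarrow> ('v::countable \<Rightarrow> 'v \<Rightarrow> bool) \<Rightarrow> ('v \<Rightarrow> 'v \<Rightarrow> real) \<Rightarrow> (nat \<Rightarrow> 'a \<Rightarrow> 'v) \<Rightarrow> bool" where
  "network_walk M E c S \<longleftrightarrow>
     prob_space M \<and>
     (\<forall>n. S n \<in> measurable M (count_space UNIV)) \<and>
     (\<forall>n v. measure M {\<omega> \<in> space M. \<forall>i\<le>Suc n. S i \<omega> = v i} =
            measure M {\<omega> \<in> space M. \<forall>i\<le>n. S i \<omega> = v i} * jump_prob E c (v n) (v (Suc n)))"

(* The family consisting of X 0 and all increments is independent, and the increments share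
   one law. *)
definition random_walk ::
  "'a measure \<Rightarrow> (nat \<Rightarrow> 'a \<Rightarrow> 'g::{countable, ab_group_add}) \<Rightarrow> bool" where
  "random_walk M X \<longleftrightarrow>
     prob_space M \<and>
     prob_space.indep_vars M (\<lambda>_. count_space UNIV)
       (\<lambda>n \<omega>. case n of 0 \<Rightarrow> X 0 \<omega> | Suc k \<Rightarrow> X (Suc k) \<omega> - X k \<omega>) UNIV \<and>
     (\<forall>n. distr M (count_space UNIV) (\<lambda>\<omega>. X (Suc n) \<omega> - X n \<omega>) =
          distr M (count_space UNIV) (\<lambda>\<omega>. X 1 \<omega> - X 0 \<omega>))"

definition recurrent_random_walk ::
  "'a measure \<Rightarrow> (nat \<Rightarrow> 'a \<Rightarrow> 'g::{countable, ab_group_add}) \<Rightarrow> bool" where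
  "recurrent_random_walk M X \<longleftrightarrow>
     random_walk M X \<and> (AE \<omega> in M. \<exists>n>0. X n \<omega> = X 0 \<omega>)"

end

theory Submission
  imports Defs
begin

text \<open>
  The step law of the network walk does not depend on the position, so \<open>S\<close> and \<open>S'\<close> are random walks
  with a common step law, and \<open>S\<^sub>n - S\<^sub>0\<close> and \<open>S'\<^sub>n - S'\<^sub>0\<close> are independent with a common law \<open>p\<^sub>n\<close>.
  Hence \<open>S - S'\<close> is back at its starting point at time \<open>n\<close> with probability \<open>\<Sum>\<^sub>v p\<^sub>n(v)^2\<close>. By Hoeffding's
  inequality \<open>p\<^sub>n\<close> gives mass at least \<open>1/2\<close> to a set of \<open>O(n)\<close> lattice points, so by Cauchy-Schwarz
  this probability is at least \<open>c/n\<close>, and its sum over \<open>n\<close> diverges. If \<open>q\<close> is the probability of never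
  returning, the events "the last visit to the starting point is at time \<open>n\<close>" are disjoint, and their
  probabilities are \<open>q\<close> times the return probabilities; since these sum to at most \<open>1\<close>, we get \<open>q = 0\<close>
  and almost surely there is no last visit.
\<close>

section \<open>Sequences of discrete random variables\<close>

lemma measurable_count_space_binop:
  fixes f :: "'a \<Rightarrow> 'b::countable" and g :: "'a \<Rightarrow> 'c::countable"
  assumes "f \<in> measurable M (count_space UNIV)" "g \<in> measurable M (count_space UNIV)"
  shows "(\<lambda>x. h (f x) (g x)) \<in> measurable M (count_space UNIV)"
proof (rule measurable_compose_countable[OF _ assms(1)])
  fix i
  show "(\<lambda>x. h i (g x)) \<in> measurable M (count_space UNIV)"
    using assms(2) by (rule measurable_compose) simp
qed

lemma measurable_count_space_sum:
  fixes f :: "'i \<Rightarrow> 'a \<Rightarrow> 'b::{countable, comm_monoid_add}"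
  assumes "\<And>i. i \<in> I \<Longrightarrow> f i \<in> measurable M (count_space UNIV)"
  shows "(\<lambda>x. \<Sum>i\<in>I. f i x) \<in> measurable M (count_space UNIV)"
  using assms
proof (induction I rule: infinite_finite_induct)
  case (insert i I)
  then show ?case
    using measurable_count_space_binop[of "f i" M "\<lambda>x. \<Sum>i\<in>I. f i x" "(+)"] by simp
qed simp_all

text \<open>On a countable space a law is fixed by its point masses, so \<open>cyl\<close> says that
  \<open>U 0\<close>, ..., \<open>U n\<close> jointly have the law \<open>PiM {..n} N\<close>. The
  measures \<open>N i\<close> are only candidates at first; since they have total mass 1, projecting
  the product shows that they are the marginals.\<close>

lemma (in prob_space) indep_vars_of_cylinders:
  fixes U :: "nat \<Rightarrow> 'a \<Rightarrow> 'b::countable"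
  assumes rv: "\<And>n. U n \<in> measurable M (count_space UNIV)"
    and N: "\<And>n. prob_space (N n)" "\<And>n. sets (N n) = UNIV"
    and cyl: "\<And>n v. prob {\<omega> \<in> space M. \<forall>i\<le>n. U i \<omega> = v i} = (\<Prod>i\<le>n. measure (N i) {v i})"
  shows "indep_vars (\<lambda>_. count_space UNIV) U UNIV"
    and "distr M (count_space UNIV) (U n) = N n"
proof -
  have spN: "space (N i) = UNIV" for i
    using sets_eq_imp_space_eq[of "N i" "count_space UNIV"] N(2) by simp
  have joint: "distr M (PiM {..n} (\<lambda>_. count_space UNIV)) (\<lambda>\<omega>. \<lambda>i\<in>{..n}. U i \<omega>) = PiM {..n} N"
    (is "?L = ?R") for n
  proof (rule measure_eqI_countable)
    have Pow: "sets (PiM {..n} (\<lambda>_. count_space UNIV)) = Pow (PiE {..n} (\<lambda>_. UNIV :: 'b set))"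
      by (subst count_space_PiM_finite) auto
    have cong: "sets (PiM {..n} N) = sets (PiM {..n} (\<lambda>_. count_space UNIV))"
      by (rule sets_PiM_cong) (auto simp: N)
    show "sets ?L = Pow (PiE {..n} (\<lambda>_. UNIV :: 'b set))" using Pow by simp
    show "sets ?R = Pow (PiE {..n} (\<lambda>_. UNIV :: 'b set))" using Pow cong by simp
    show "countable (PiE {..n} (\<lambda>_. UNIV :: 'b set))" by (intro countable_PiE) auto
    fix f :: "nat \<Rightarrow> 'b" assume f: "f \<in> PiE {..n} (\<lambda>_. UNIV)"
    have m: "(\<lambda>\<omega>. \<lambda>i\<in>{..n}. U i \<omega>) \<in> measurable M (PiM {..n} (\<lambda>_. count_space UNIV))"
      using rv by (intro measurable_restrict) auto
    have "emeasure ?L {f} = emeasure M ((\<lambda>\<omega>. \<lambda>i\<in>{..n}. U i \<omega>) -` {f} \<inter> space M)"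
      using f by (intro emeasure_distr m) (simp add: Pow)
    also have "(\<lambda>\<omega>. \<lambda>i\<in>{..n}. U i \<omega>) -` {f} \<inter> space M = {\<omega> \<in> space M. \<forall>i\<le>n. U i \<omega> = f i}"
      using f by (auto simp: fun_eq_iff PiE_def extensional_def restrict_def)
    also have "emeasure M \<dots> = ennreal (\<Prod>i\<le>n. measure (N i) {f i})"
      by (simp add: emeasure_eq_measure cyl)
    also have "\<dots> = (\<Prod>i\<le>n. emeasure (N i) {f i})"
    proof -
      have "emeasure (N i) {f i} = ennreal (measure (N i) {f i})" for i
      proof -
        interpret Ni: prob_space "N i" by (rule N)
        show ?thesis by (rule Ni.emeasure_eq_measure)
      qed
      then show ?thesis by (simp add: prod_ennreal)
    qed
    also have "\<dots> = emeasure ?R (PiE {..n} (\<lambda>i. {f i}))"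
    proof -
      interpret product_prob_space N "{..n}"
        using N(1) by unfold_locales (auto simp: prob_space_def prob_space_axioms_def
          finite_measure_def sigma_finite_measure_def finite_measure_axioms_def)
      show ?thesis by (rule emeasure_PiM[symmetric]) (auto simp: N)
    qed
    also have "PiE {..n} (\<lambda>i. {f i}) = {f}"
      using f by (intro PiE_singleton) (auto simp: PiE_def)
    finally show "emeasure ?L {f} = emeasure ?R {f}" .
  qed
  have marg: "distr M (count_space UNIV) (U i) = N i" if "i \<le> n" for i n
  proof -
    have "distr M (count_space UNIV) (U i) =
      distr (distr M (PiM {..n} (\<lambda>_. count_space UNIV)) (\<lambda>\<omega>. \<lambda>i\<in>{..n}. U i \<omega>)) (count_space UNIV) (\<lambda>f. f i)"
      using that rv by (subst distr_distr) (auto simp: o_def intro!: measurable_restrict)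
    also have "\<dots> = distr (PiM {..n} N) (N i) (\<lambda>f. f i)"
      unfolding joint by (rule distr_cong) (auto simp: N)
    also have "\<dots> = N i"
      using that by (intro distr_PiM_component N) auto
    finally show ?thesis .
  qed
  then show "distr M (count_space UNIV) (U n) = N n" by blast
  have fin: "indep_vars (\<lambda>_. count_space UNIV) U {..n}" for n
    using rv marg by (subst indep_vars_iff_distr_eq_PiM') (auto simp: joint intro!: PiM_cong)
  show "indep_vars (\<lambda>_. count_space UNIV) U UNIV"
    \<comment> \<open>Independence of an infinite family only concerns finite index sets
      \<open>J\<close>, and each of them lies in some \<open>{..Max J}\<close>.\<close>
    unfolding indep_vars_def
  proof (intro conjI ballI rv, subst indep_sets_finite_index_sets, intro allI impI)
    fix J :: "nat set" assume "finite J" "J \<noteq> {}"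
    then have "indep_vars (\<lambda>_. count_space UNIV) U J"
      by (intro indep_vars_subset[OF fin[of "Max J"]]) auto
    then show "indep_sets (\<lambda>i. sigma_sets (space M) {U i -` A \<inter> space M |A. A \<in> sets (count_space UNIV)}) J"
      unfolding indep_vars_def by blast
  qed
qed

text \<open>Injectivity makes the singleton blocks \<open>{f j}\<close> disjoint, so the blocks are
  independent; evaluating block \<open>j\<close> at \<open>f j\<close> gives the claim.\<close>

lemma (in prob_space) indep_vars_inj_reindex:
  assumes X: "indep_vars M' X I" and f: "inj_on f J" "f ` J \<subseteq> I"
  shows "indep_vars (\<lambda>j. M' (f j)) (\<lambda>j. X (f j)) J"
proof -
  have "indep_vars (\<lambda>j. PiM {f j} M') (\<lambda>j \<omega>. restrict (\<lambda>i. X i \<omega>) {f j}) J"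
    using f by (intro indep_vars_restrict[OF X]) (auto simp: disjoint_family_on_def inj_on_def)
  then have "indep_vars (\<lambda>j. M' (f j)) (\<lambda>j \<omega>. (\<lambda>y. y (f j)) (restrict (\<lambda>i. X i \<omega>) {f j})) J"
    by (rule indep_vars_compose2) auto
  then show ?thesis by simp
qed

text \<open>The law of the whole sequence depends on \<open>D\<close> alone. This serves to compare
  a step sequence with its shifts, and the steps of one walk with those of another.\<close>

lemma (in prob_space) distr_iid_sequence:
  fixes Y :: "nat \<Rightarrow> 'a \<Rightarrow> 'b"
  assumes "indep_vars (\<lambda>_. count_space UNIV) Y UNIV"
    and "\<And>n. distr M (count_space UNIV) (Y n) = D"
  shows "distr M (PiM UNIV (\<lambda>_. count_space UNIV)) (\<lambda>\<omega> n. Y n \<omega>) = PiM UNIV (\<lambda>_. D)"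
proof -
  have "random_variable (count_space UNIV) (Y n)" for n
    using assms(1) by (auto simp: indep_vars_def)
  then show ?thesis
    using indep_vars_iff_distr_eq_PiM'[of UNIV Y "\<lambda>_. count_space UNIV"] assms
    by (simp add: restrict_UNIV)
qed

section \<open>Recurrence from a divergent Green's function\<close>

text \<open>Last-exit decomposition: a visit at time \<open>n\<close> is the last one iff the later
  steps never sum to 0, and those steps are independent of the earlier ones and have the same law as
  the steps from time 0 on.\<close>

lemma AE_infinite_returns:
  fixes X :: "nat \<Rightarrow> 'a \<Rightarrow> 'g::{countable, ab_group_add}"
  assumes X: "random_walk M X"
    and div: "\<not> summable (\<lambda>n. measure M {\<omega> \<in> space M. X n \<omega> = X 0 \<omega>})"
  shows "AE \<omega> in M. infinite {n. X n \<omega> = X 0 \<omega>}"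
proof -
  interpret prob_space M using X by (simp add: random_walk_def)
  define Y where "Y n \<omega> = X (Suc n) \<omega> - X n \<omega>" for n \<omega>
  define D where "D = distr M (count_space UNIV) (Y 0)"
  have distr_Y: "distr M (count_space UNIV) (Y n) = D" for n
    using X unfolding random_walk_def D_def Y_def One_nat_def by blast
  let ?Z = "\<lambda>n \<omega>. case n of 0 \<Rightarrow> X 0 \<omega> | Suc k \<Rightarrow> X (Suc k) \<omega> - X k \<omega>"
  have indep_Z: "indep_vars (\<lambda>_. count_space UNIV) ?Z UNIV"
    using X by (simp add: random_walk_def)
  have indep_Y: "indep_vars (\<lambda>_. count_space UNIV) Y UNIV"
    using indep_vars_inj_reindex[OF indep_Z, of Suc UNIV] by (simp add: Y_def[abs_def])
  have rv_Y: "random_variable (count_space UNIV) (Y n)" for n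
    using indep_Y by (auto simp: indep_vars_def)
  have diff: "X m \<omega> - X n \<omega> = (\<Sum>k\<in>{n..<m}. Y k \<omega>)" if "n \<le> m" for m n \<omega>
    unfolding Y_def using sum_Suc_diff'[OF that, of "\<lambda>k. X k \<omega>"] by simp
  define u where "u n = prob {\<omega> \<in> space M. X n \<omega> = X 0 \<omega>}" for n
  define q where "q = prob {\<omega> \<in> space M. \<forall>m>0. X m \<omega> \<noteq> X 0 \<omega>}"
  define A where "A n = {\<omega> \<in> space M. X n \<omega> = X 0 \<omega> \<and> (\<forall>m>n. X m \<omega> \<noteq> X 0 \<omega>)}" for n
  have rv_X: "random_variable (count_space UNIV) (\<lambda>\<omega>. X m \<omega> - X n \<omega>)" if "n \<le> m" for m n
    unfolding diff[OF that] by (intro measurable_count_space_sum rv_Y)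
  \<comment> \<open>Non-return is phrased as a set of step sequences, not of outcomes, so that it
    can be evaluated on any shift of \<open>Y\<close>.\<close>
  define E where "E = {y :: nat \<Rightarrow> 'g. \<forall>m>0. (\<Sum>k<m. y k) \<noteq> 0}"
  have E: "E \<in> sets (PiM UNIV (\<lambda>_. count_space UNIV))"
  proof -
    have [measurable]: "(\<lambda>y. \<Sum>k<m. y k) \<in> measurable (PiM UNIV (\<lambda>_. count_space UNIV)) (count_space (UNIV :: 'g set))" for m :: nat
      by (intro measurable_count_space_sum measurable_component_singleton) auto
    have "{y \<in> space (PiM UNIV (\<lambda>_. count_space UNIV)). \<forall>m>0. (\<Sum>k<m. y k) \<noteq> (0::'g)}
        \<in> sets (PiM (UNIV :: nat set) (\<lambda>_. count_space UNIV))"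
      by measurable
    then show ?thesis by (simp add: E_def space_PiM)
  qed
  \<comment> \<open>The walk seen from time \<open>n\<close> on has the same law as the walk seen from time \<open>0\<close>.\<close>
  have shift: "prob {\<omega> \<in> space M. (\<lambda>k. Y (n + k) \<omega>) \<in> E} = measure (PiM UNIV (\<lambda>_. D)) E" for n
  proof -
    have "indep_vars (\<lambda>_. count_space UNIV) (\<lambda>k. Y (n + k)) UNIV"
      by (rule indep_vars_inj_reindex[OF indep_Y]) auto
    then have "PiM UNIV (\<lambda>_. D) = distr M (PiM UNIV (\<lambda>_. count_space UNIV)) (\<lambda>\<omega> k. Y (n + k) \<omega>)"
      by (intro distr_iid_sequence[symmetric] distr_Y)
    moreover have "(\<lambda>\<omega> k. Y (n + k) \<omega>) \<in> measurable M (PiM UNIV (\<lambda>_. count_space UNIV))"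
      using measurable_restrict[of UNIV "\<lambda>k. Y (n + k)" M "\<lambda>_. count_space UNIV"] rv_Y
      by (simp add: restrict_UNIV)
    ultimately show ?thesis
      using E by (simp add: measure_distr vimage_def Int_def conj_commute)
  qed
  have tail: "(\<lambda>k. Y (n + k) \<omega>) \<in> E \<longleftrightarrow> (\<forall>m>n. X m \<omega> \<noteq> X n \<omega>)" for n \<omega>
  proof -
    have s: "(\<Sum>k<m. Y (n + k) \<omega>) = X (n + m) \<omega> - X n \<omega>" for m
      using sum.shift_bounds_nat_ivl[of "\<lambda>k. Y k \<omega>" 0 n m] diff[of n "n + m" \<omega>]
      by (simp add: add.commute lessThan_atLeast0)
    show ?thesis
      unfolding E_def mem_Collect_eq s right_minus_eq
      by (metis add_diff_inverse_nat less_add_same_cancel1 less_imp_not_less zero_less_diff)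
  qed
  have q_eq: "q = measure (PiM UNIV (\<lambda>_. D)) E"
    using shift[of 0] tail[of 0] by (simp add: q_def)
  have prob_A: "prob (A n) = u n * q" for n
  proof -
    let ?P = "\<lambda>K. PiM K (\<lambda>_. count_space (UNIV :: 'g set))"
    \<comment> \<open>\<open>A n\<close> is split into an event \<open>?a\<close> about the steps
      before \<open>n\<close> and an event \<open>?b\<close> about those from \<open>n\<close> on.
      Since \<open>X n\<close> equals \<open>X 0\<close> on \<open>?a\<close>, avoiding
      \<open>X n\<close> after time \<open>n\<close> amounts to avoiding \<open>X 0\<close>.\<close>
    let ?a = "{y \<in> space (?P {..<n}). (\<Sum>k<n. y k) = 0}"
    let ?b = "{y \<in> space (?P {n..}). \<forall>m>n. (\<Sum>k\<in>{n..<m}. y k) \<noteq> 0}"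
    have ind: "indep_var (?P {..<n}) (\<lambda>\<omega>. \<lambda>i\<in>{..<n}. Y i \<omega>) (?P {n..}) (\<lambda>\<omega>. \<lambda>i\<in>{n..}. Y i \<omega>)"
      by (intro indep_var_restrict[OF indep_Y]) auto
    have [measurable]: "(\<lambda>y. \<Sum>k<n. y k) \<in> measurable (?P {..<n}) (count_space UNIV)"
      by (intro measurable_count_space_sum measurable_component_singleton) auto
    have [measurable]: "(\<lambda>y. \<Sum>k\<in>{n..<m}. y k) \<in> measurable (?P {n..}) (count_space UNIV)" for m
      by (intro measurable_count_space_sum measurable_component_singleton) auto
    have a: "?a \<in> sets (?P {..<n})" by measurable
    have b: "?b \<in> sets (?P {n..})" by measurable
    have sum_a: "(\<Sum>k<n. Y k \<omega>) = 0 \<longleftrightarrow> X n \<omega> = X 0 \<omega>" for \<omega>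
      by (simp add: lessThan_atLeast0 diff[symmetric])
    have sum_b: "(\<forall>m>n. (\<Sum>k\<in>{n..<m}. Y k \<omega>) \<noteq> 0) \<longleftrightarrow> (\<forall>m>n. X m \<omega> \<noteq> X n \<omega>)" for \<omega>
      by (simp add: diff[symmetric])
    have eq_a: "(\<lambda>\<omega>. \<lambda>i\<in>{..<n}. Y i \<omega>) -` ?a \<inter> space M = {\<omega> \<in> space M. X n \<omega> = X 0 \<omega>}"
      by (auto simp: space_PiM sum_a)
    have eq_b: "(\<lambda>\<omega>. \<lambda>i\<in>{n..}. Y i \<omega>) -` ?b \<inter> space M = {\<omega> \<in> space M. (\<lambda>k. Y (n + k) \<omega>) \<in> E}"
      by (auto simp: space_PiM sum_b tail)
    have "prob (A n) = prob ((\<lambda>\<omega>. (\<lambda>i\<in>{..<n}. Y i \<omega>, \<lambda>i\<in>{n..}. Y i \<omega>)) -` (?a \<times> ?b) \<inter> space M)"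
    proof (rule arg_cong[where f = prob])
      have "(\<lambda>\<omega>. (\<lambda>i\<in>{..<n}. Y i \<omega>, \<lambda>i\<in>{n..}. Y i \<omega>)) -` (?a \<times> ?b) \<inter> space M =
        ((\<lambda>\<omega>. \<lambda>i\<in>{..<n}. Y i \<omega>) -` ?a \<inter> space M) \<inter> ((\<lambda>\<omega>. \<lambda>i\<in>{n..}. Y i \<omega>) -` ?b \<inter> space M)"
        by blast
      also have "\<dots> = A n"
        unfolding eq_a eq_b tail A_def by auto
      finally show "A n = (\<lambda>\<omega>. (\<lambda>i\<in>{..<n}. Y i \<omega>, \<lambda>i\<in>{n..}. Y i \<omega>)) -` (?a \<times> ?b) \<inter> space M" ..
    qed
    also have "\<dots> = u n * q"
      unfolding indep_varD[OF ind a b] eq_a eq_b shift u_def q_eq ..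
    finally show ?thesis .
  qed
  have [measurable]: "(\<lambda>\<omega>. X m \<omega> - X 0 \<omega>) \<in> measurable M (count_space UNIV)" for m
    by (rule rv_X) simp
  have A_events: "A n \<in> events" for n
  proof -
    have "{\<omega> \<in> space M. X n \<omega> - X 0 \<omega> = 0 \<and> (\<forall>m>n. X m \<omega> - X 0 \<omega> \<noteq> 0)} \<in> events"
      by measurable
    then show ?thesis by (simp add: A_def)
  qed
  have "disjoint_family A"
    unfolding disjoint_family_on_def A_def by (auto dest: linorder_neqE_nat)
  then have "(\<lambda>n. prob (A n)) sums prob (\<Union>n. A n)"
    using A_events by (intro finite_measure_UNION) auto
  then have "summable (\<lambda>n. u n * q)"
    by (auto simp: prob_A sums_iff)
  then have "q = 0"
    using div summable_divide[of "\<lambda>n. u n * q" q] by (cases "q = 0") (auto simp: u_def[abs_def])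
  then have "A n \<in> null_sets M" for n
    using A_events prob_A[of n] by (auto simp: null_sets_def emeasure_eq_measure)
  then have "AE \<omega> in M. \<forall>n. \<omega> \<notin> A n"
    by (subst AE_all_countable) (auto intro: AE_not_in)
  then show ?thesis
  proof (rule AE_mp, intro AE_I2 impI notI)
    fix \<omega> assume \<omega>: "\<omega> \<in> space M" "\<forall>n. \<omega> \<notin> A n" and fin: "finite {n. X n \<omega> = X 0 \<omega>}"
    \<comment> \<open>The maximum exists because the set of visits contains time 0.\<close>
    obtain n where "X n \<omega> = X 0 \<omega>" and "\<And>m. X m \<omega> = X 0 \<omega> \<Longrightarrow> m \<le> n"
      using Max_in[OF fin] Max_ge[OF fin] by blast
    then have "\<omega> \<in> A n" using \<omega>(1) by (force simp: A_def)
    with \<omega>(2) show False by blast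
  qed
qed

section \<open>Collisions of independent planar sums\<close>

text \<open>With \<open>p v\<close> the common point mass, independence makes
  \<open>(p v)\<^sup>2\<close> the probability that both variables equal \<open>v\<close>.
  Cauchy-Schwarz against the constant 1 on \<open>B\<close> bounds the squared mass of
  \<open>B\<close> by \<open>card B\<close> times the sum of these squares.\<close>

lemma (in prob_space) prob_collision_ge:
  fixes T T' :: "'a \<Rightarrow> 'b::countable"
  assumes ind: "indep_var (count_space UNIV) T (count_space UNIV) T'"
    and eq: "distr M (count_space UNIV) T = distr M (count_space UNIV) T'"
    and B: "finite B"
  shows "(prob {\<omega> \<in> space M. T \<omega> \<in> B})\<^sup>2 \<le> card B * prob {\<omega> \<in> space M. T \<omega> = T' \<omega>}"
proof -
  have [measurable]: "T \<in> measurable M (count_space UNIV)" "T' \<in> measurable M (count_space UNIV)"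
    using ind by (auto dest: indep_var_rv1 indep_var_rv2)
  define p where "p v = prob {\<omega> \<in> space M. T \<omega> = v}" for v
  have p': "prob {\<omega> \<in> space M. T' \<omega> = v} = p v" for v
  proof -
    have "measure (distr M (count_space UNIV) T) {v} = measure (distr M (count_space UNIV) T') {v}"
      by (simp add: eq)
    then show ?thesis by (simp add: measure_distr p_def vimage_def Int_def conj_commute)
  qed
  have both: "prob {\<omega> \<in> space M. T \<omega> = v \<and> T' \<omega> = v} = (p v)\<^sup>2" for v
  proof -
    have "{\<omega> \<in> space M. T \<omega> = v \<and> T' \<omega> = v} = (\<lambda>x. (T x, T' x)) -` ({v} \<times> {v}) \<inter> space M"
      by auto
    then have "prob {\<omega> \<in> space M. T \<omega> = v \<and> T' \<omega> = v} = prob (T -` {v} \<inter> space M) * prob (T' -` {v} \<inter> space M)"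
      using indep_varD[OF ind, of "{v}" "{v}"] by simp
    also have "T -` {v} \<inter> space M = {\<omega> \<in> space M. T \<omega> = v}" by auto
    also have "T' -` {v} \<inter> space M = {\<omega> \<in> space M. T' \<omega> = v}" by auto
    finally show ?thesis by (simp add: p' power2_eq_square) (simp add: p_def)
  qed
  have "prob {\<omega> \<in> space M. T \<omega> \<in> B} = prob (\<Union>v\<in>B. {\<omega> \<in> space M. T \<omega> = v})"
    by (intro arg_cong[where f = prob]) auto
  also have "\<dots> = (\<Sum>v\<in>B. p v)"
    unfolding p_def using B
    by (intro finite_measure_finite_Union) (auto simp: disjoint_family_on_def)
  finally have "(prob {\<omega> \<in> space M. T \<omega> \<in> B})\<^sup>2 = (\<Sum>v\<in>B. 1 * p v)\<^sup>2" by simp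
  also have "\<dots> \<le> (\<Sum>v\<in>B. 1\<^sup>2) * (\<Sum>v\<in>B. (p v)\<^sup>2)"
    by (rule Cauchy_Schwarz_ineq_sum)
  also have "(\<Sum>v\<in>B. (p v)\<^sup>2) = prob (\<Union>v\<in>B. {\<omega> \<in> space M. T \<omega> = v \<and> T' \<omega> = v})"
    unfolding both[symmetric] using B
    by (intro finite_measure_finite_Union[symmetric]) (auto simp: disjoint_family_on_def)
  also have "(\<Sum>v\<in>B. 1\<^sup>2) * \<dots> \<le> card B * prob {\<omega> \<in> space M. T \<omega> = T' \<omega>}"
    by (simp, intro mult_left_mono finite_measure_mono) auto
  finally show ?thesis by simp
qed

text \<open>The hypothesis makes the bound nonnegative, which covers intervals that contain no
  integer.\<close>

lemma card_int_interval_le: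
  fixes a b :: real
  assumes "a \<le> b + 1"
  shows "finite {k::int. a \<le> k \<and> k \<le> b}" and "card {k::int. a \<le> k \<and> k \<le> b} \<le> b - a + 1"
proof -
  have *: "{k::int. a \<le> k \<and> k \<le> b} = {\<lceil>a\<rceil>..\<lfloor>b\<rfloor>}"
    by (auto simp: ceiling_le_iff le_floor_iff)
  show "finite {k::int. a \<le> k \<and> k \<le> b}" by (simp add: *)
  show "card {k::int. a \<le> k \<and> k \<le> b} \<le> b - a + 1"
    unfolding * card_atLeastAtMost_int using assms
    by (cases "\<lfloor>b\<rfloor> - \<lceil>a\<rceil> + 1 \<ge> 0") (simp_all, linarith+)
qed

text \<open>By Hoeffding's inequality each coordinate sum stays within order \<open>sqrt n\<close>
  of its mean. The square \<open>B\<close> is centred at that mean, so a drift of the steps moves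
  \<open>B\<close> but does not enlarge it.\<close>

lemma (in prob_space) sum_in_square:
  fixes \<xi> :: "nat \<Rightarrow> 'a \<Rightarrow> int \<times> int"
  assumes ind: "indep_vars (\<lambda>_. count_space UNIV) \<xi> UNIV"
    and bd: "\<And>i. AE \<omega> in M. \<bar>fst (\<xi> i \<omega>)\<bar> \<le> 1 \<and> \<bar>snd (\<xi> i \<omega>)\<bar> \<le> 1"
    and n: "n > 0"
  obtains B where "finite B" "card B \<le> 49 * real n"
    "prob {\<omega> \<in> space M. (\<Sum>i<n. \<xi> i \<omega>) \<in> B} \<ge> 1/2"
proof -
  \<comment> \<open>Steps ranging over an interval of length 2 give the Hoeffding exponent
    \<open>- 2 * r\<^sup>2 / (4 * n)\<close>, which is \<open>- 9/2\<close> for this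
    \<open>r\<close>. Each coordinate then fails with probability at most 1/4, and both together
    with at most 1/2.\<close>
  define r where "r = 3 * sqrt n"
  have r: "r \<ge> 0" "r\<^sup>2 = 9 * n" by (simp_all add: r_def power_mult_distrib)
  have rv[measurable]: "random_variable (count_space UNIV) (\<xi> i)" for i
    using ind by (auto simp: indep_vars_def)
  have msum: "(\<lambda>\<omega>. \<Sum>i<n. \<xi> i \<omega>) \<in> measurable M (count_space UNIV)"
    by (intro measurable_count_space_sum rv)
  have tail: "\<exists>\<mu>. prob {\<omega> \<in> space M. \<bar>real_of_int (\<Sum>i<n. g (\<xi> i \<omega>)) - \<mu>\<bar> \<ge> r} \<le> 1/4"
    if g: "\<And>i. AE \<omega> in M. \<bar>g (\<xi> i \<omega>)\<bar> \<le> 1" for g :: "int \<times> int \<Rightarrow> int"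
  proof -
    have ind': "indep_vars (\<lambda>_. borel) (\<lambda>i \<omega>. real_of_int (g (\<xi> i \<omega>))) {..<n}"
      by (rule indep_vars_compose2[OF indep_vars_subset[OF ind]]) auto
    interpret Hoeffding_ineq M "{..<n}" "\<lambda>i \<omega>. real_of_int (g (\<xi> i \<omega>))" "\<lambda>_. -1" "\<lambda>_. 1"
      "\<Sum>i<n. expectation (\<lambda>\<omega>. real_of_int (g (\<xi> i \<omega>)))"
    proof (unfold_locales)
      fix i show "AE \<omega> in M. real_of_int (g (\<xi> i \<omega>)) \<in> {-1..1}"
        using g[of i] by (rule AE_mp) (intro AE_I2 impI, auto simp: abs_le_iff)
    qed (use ind' in auto)
    \<comment> \<open>From e >= 2 follows exp(9/2) >= 8, so the two-sided bound is at most
      2/8.\<close>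
    have "8 \<le> (exp 1 :: real) ^ 3"
      using power_mono[of 2 "exp 1 :: real" 3] exp_ge_add_one_self[of 1] by simp
    also have "\<dots> \<le> exp (9/2)" by (simp flip: exp_of_nat_mult)
    finally have small: "2 * exp (- (9/2)) \<le> (1/4 :: real)"
      by (simp add: exp_minus field_simps)
    have exponent: "- 2 * r\<^sup>2 / (\<Sum>i<n. (1 - (-1))\<^sup>2) = - (9/2)"
      using n by (simp add: r)
    have pos: "(\<Sum>i<n. (1 - (-1))\<^sup>2) > (0::real)" using n by simp
    have "prob {\<omega> \<in> space M. \<bar>(\<Sum>i<n. real_of_int (g (\<xi> i \<omega>))) -
        (\<Sum>i<n. expectation (\<lambda>\<omega>. real_of_int (g (\<xi> i \<omega>))))\<bar> \<ge> r} \<le> 1/4"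
      using Hoeffding_ineq_abs_ge[OF r(1) pos] small unfolding exponent by (rule order_trans)
    then show ?thesis unfolding of_int_sum by (rule exI)
  qed
  obtain \<mu> where \<mu>: "prob {\<omega> \<in> space M. \<bar>real_of_int (\<Sum>i<n. fst (\<xi> i \<omega>)) - \<mu>\<bar> \<ge> r} \<le> 1/4"
    using tail[of fst] bd unfolding AE_conj_iff by blast
  obtain \<nu> where \<nu>: "prob {\<omega> \<in> space M. \<bar>real_of_int (\<Sum>i<n. snd (\<xi> i \<omega>)) - \<nu>\<bar> \<ge> r} \<le> 1/4"
    using tail[of snd] bd unfolding AE_conj_iff by blast
  define I where "I m = {k::int. m - r \<le> k \<and> k \<le> m + r}" for m
  have I: "finite (I m)" "card (I m) \<le> 7 * sqrt n" for m
  proof -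
    show "finite (I m)" unfolding I_def using r by (intro card_int_interval_le) auto
    have "card (I m) \<le> 2 * r + 1"
      unfolding I_def using r card_int_interval_le(2)[of "m - r" "m + r"] by simp
    \<comment> \<open>Here \<open>2 * r\<close> is \<open>6 * sqrt n\<close>, and
      \<open>n > 0\<close> gives 1 <= \<open>sqrt n\<close>. The product of two such intervals
      accounts for the constant 49.\<close>
    also have "\<dots> \<le> 7 * sqrt n" using n by (simp add: r_def)
    finally show "card (I m) \<le> 7 * sqrt n" .
  qed
  show ?thesis
  proof
    show "finite (I \<mu> \<times> I \<nu>)" using I by simp
    have "real (card (I \<mu> \<times> I \<nu>)) \<le> (7 * sqrt n) * (7 * sqrt n)"
      unfolding card_cartesian_product of_nat_mult by (intro mult_mono I) auto
    then show "card (I \<mu> \<times> I \<nu>) \<le> 49 * real n" by simp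
    let ?G = "{\<omega> \<in> space M. (\<Sum>i<n. \<xi> i \<omega>) \<in> I \<mu> \<times> I \<nu>}"
    let ?F = "{\<omega> \<in> space M. \<bar>real_of_int (\<Sum>i<n. fst (\<xi> i \<omega>)) - \<mu>\<bar> \<ge> r}"
    let ?H = "{\<omega> \<in> space M. \<bar>real_of_int (\<Sum>i<n. snd (\<xi> i \<omega>)) - \<nu>\<bar> \<ge> r}"
    have G: "?G \<in> events"
      using measurable_sets[OF msum, of "I \<mu> \<times> I \<nu>"] by (simp add: vimage_def Int_def conj_commute)
    have m: "(\<lambda>\<omega>. \<Sum>i<n. g (\<xi> i \<omega>)) \<in> measurable M (count_space UNIV)" for g :: "int \<times> int \<Rightarrow> int"
      by (intro measurable_count_space_sum measurable_compose[OF rv]) auto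
    note [measurable] = m[of fst] m[of snd]
    have F: "?F \<in> events" and H: "?H \<in> events" by measurable
    \<comment> \<open>Outside the two tail events \<open>?F\<close> and \<open>?H\<close> both
      coordinate sums lie in their intervals, so the three events cover the space.\<close>
    have "1 = prob (space M)" by (simp add: prob_space)
    also have "\<dots> \<le> prob (?G \<union> (?F \<union> ?H))"
      using F G H by (intro finite_measure_mono) (auto simp: I_def fst_sum snd_sum abs_le_iff mem_Times_iff)
    also have "\<dots> \<le> prob ?G + (prob ?F + prob ?H)"
      using F G H by (intro order_trans[OF measure_Un_le] add_left_mono measure_Un_le) auto
    finally show "prob ?G \<ge> 1/2" using \<mu> \<nu> by simp
  qed
qed

lemma not_summable_ge_inverse:
  fixes u :: "nat \<Rightarrow> real"
  assumes "\<And>n. n > 0 \<Longrightarrow> c / n \<le> u n" "c > 0"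
  shows "\<not> summable u"
proof
  assume "summable u"
  then have "summable (\<lambda>n. u n / c)" by (rule summable_divide)
  then have "summable (\<lambda>n. inverse (real n))"
  proof (rule summable_comparison_test'[where N = 1])
    fix n :: nat assume "n \<ge> 1"
    then show "norm (inverse (real n)) \<le> u n / c"
      using assms(1)[of n] assms(2) by (simp add: field_simps)
  qed
  then show False using not_summable_harmonic[where 'a = real] by simp
qed

section \<open>The network walk\<close>

definition step_pmf :: "real \<Rightarrow> (int \<times> int) pmf" where
  "step_pmf lam = pmf_of_list
     [((1, 0), exp lam / (3 + exp lam)), ((-1, 0), 1 / (3 + exp lam)),
      ((0, 1), 1 / (3 + exp lam)), ((0, -1), 1 / (3 + exp lam))]"

lemma step_pmf_wf:
  fixes lam :: real
  shows
  "pmf_of_list_wf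
     [((1::int, 0::int), exp lam / (3 + exp lam)), ((-1, 0), 1 / (3 + exp lam)),
      ((0, 1), 1 / (3 + exp lam)), ((0, -1), 1 / (3 + exp lam))]"
proof -
  have "3 + exp lam > 0" using exp_gt_zero[of lam] by linarith
  then show ?thesis by (auto simp: pmf_of_list_wf_def simp flip: add_divide_distrib)
qed

lemma pmf_step_pmf:
  "pmf (step_pmf lam) v =
     (if v = (1, 0) then exp lam / (3 + exp lam)
      else if v \<in> {(-1, 0), (0, 1), (0, -1)} then 1 / (3 + exp lam) else 0)"
  unfolding step_pmf_def pmf_pmf_of_list[OF step_pmf_wf] by auto

lemma set_step_pmf: "set_pmf (step_pmf lam) \<subseteq> {(1, 0), (-1, 0), (0, 1), (0, -1)}"
  by (auto simp: set_pmf_iff pmf_step_pmf split: if_splits)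

text \<open>From a point with first coordinate \<open>a\<close>, the edge to the right has
  conductance exp(lam * (a + 1)) and the other three have exp(lam * a). The factor exp(lam * a)
  cancels in the quotient, which leaves a function of \<open>v - u\<close>.\<close>

lemma jump_prob_Gamma1:
  "jump_prob lattice_adj (Gamma1_conductance lam) u v = pmf (step_pmf lam) (v - u)"
proof -
  obtain a b where u: "u = (a, b)" by (cases u)
  obtain c d where v: "v = (c, d)" by (cases v)
  have nb: "{w. lattice_adj u w} = {(a + 1, b), (a - 1, b), (a, b + 1), (a, b - 1)}"
    unfolding lattice_adj_def u by (auto simp: abs_if split: if_splits)
  have e: "exp (lam * (real_of_int a + 1)) = exp (lam * a) * exp lam"
    by (simp only: distrib_left exp_add mult_1_right)
  have tot: "(\<Sum>w | lattice_adj u w. Gamma1_conductance lam u w) = exp (lam * a) * (3 + exp lam)"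
    unfolding nb by (simp add: Gamma1_conductance_def u e max_def) (simp add: distrib_left)
  have pos: "3 + exp lam > 0" using exp_gt_zero[of lam] by linarith
  show ?thesis
  proof (cases "lattice_adj u v")
    case True
    then have "v \<in> {(a + 1, b), (a - 1, b), (a, b + 1), (a, b - 1)}" using nb by blast
    then show ?thesis
      using True pos unfolding jump_prob_def tot pmf_step_pmf
      by (auto simp: Gamma1_conductance_def u e max_def)
  next
    case False
    then have "v \<notin> {(a + 1, b), (a - 1, b), (a, b + 1), (a, b - 1)}" using nb by blast
    then show ?thesis
      using False unfolding jump_prob_def pmf_step_pmf by (auto simp: u v)
  qed
qed

section \<open>Increments of a walk\<close>

text \<open>Index 0 carries the starting point, so the partial sums recover the walk and the family
  is the one whose independence \<open>random_walk\<close> demands.\<close>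

definition increment :: "(nat \<Rightarrow> 'a \<Rightarrow> 'g::ab_group_add) \<Rightarrow> nat \<Rightarrow> 'a \<Rightarrow> 'g" where
  "increment X n \<omega> = (case n of 0 \<Rightarrow> X 0 \<omega> | Suc k \<Rightarrow> X (Suc k) \<omega> - X k \<omega>)"

lemma sum_increment: "(\<Sum>i\<le>n. increment X i \<omega>) = X n \<omega>"
  by (induction n) (simp_all add: increment_def)

text \<open>Translates cylinders of increments into cylinders of positions, in which the Markov
  property of \<open>network_walk\<close> is stated.\<close>

lemma increment_eq_iff:
  "(\<forall>i\<le>n. increment X i \<omega> = v i) \<longleftrightarrow> (\<forall>i\<le>n. X i \<omega> = (\<Sum>j\<le>i. v j))"
proof
  assume *: "\<forall>i\<le>n. increment X i \<omega> = v i"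
  show "\<forall>i\<le>n. X i \<omega> = (\<Sum>j\<le>i. v j)"
  proof (intro allI impI)
    fix i assume "i \<le> n"
    then have "(\<Sum>j\<le>i. increment X j \<omega>) = (\<Sum>j\<le>i. v j)" using * by (intro sum.cong) auto
    then show "X i \<omega> = (\<Sum>j\<le>i. v j)" by (simp add: sum_increment)
  qed
next
  assume *: "\<forall>i\<le>n. X i \<omega> = (\<Sum>j\<le>i. v j)"
  show "\<forall>i\<le>n. increment X i \<omega> = v i"
    using * by (auto simp: increment_def split: nat.split)
qed

text \<open>By \<open>jump_prob_Gamma1\<close> each transition factor depends only on the newest
  increment, so the cylinder probabilities of the increments factorise.\<close>

lemma network_walk_increments:
  assumes S: "network_walk M lattice_adj (Gamma1_conductance lam) S"
  shows "prob_space.indep_vars M (\<lambda>_. count_space UNIV) (increment S) UNIV"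
    and "distr M (count_space UNIV) (increment S (Suc n)) = measure_pmf (step_pmf lam)"
proof -
  interpret prob_space M using S by (simp add: network_walk_def)
  have rv: "S n \<in> measurable M (count_space UNIV)" for n
    using S by (simp add: network_walk_def)
  have rv': "increment S n \<in> measurable M (count_space UNIV)" for n
    using rv by (cases n) (auto simp: increment_def[abs_def] intro: measurable_count_space_binop)
  \<comment> \<open>The starting point keeps its own, arbitrary law; every later increment has the
    step law.\<close>
  define N where "N n = (case n of 0 \<Rightarrow> distr M (count_space UNIV) (S 0)
    | Suc _ \<Rightarrow> measure_pmf (step_pmf lam))" for n :: nat
  have N: "prob_space (N n)" "sets (N n) = UNIV" for n
    using rv by (auto simp: N_def measure_pmf.prob_space_axioms intro: prob_space_distr split: nat.split)
  have cyl: "prob {\<omega> \<in> space M. \<forall>i\<le>n. increment S i \<omega> = v i} = (\<Prod>i\<le>n. measure (N i) {v i})" for n v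
    unfolding increment_eq_iff
  proof (induction n)
    case 0
    show ?case using rv[of 0]
      by (simp add: N_def measure_distr vimage_def Int_def conj_commute)
  next
    case (Suc n)
    have "prob {\<omega> \<in> space M. \<forall>i\<le>Suc n. S i \<omega> = (\<Sum>j\<le>i. v j)} =
      prob {\<omega> \<in> space M. \<forall>i\<le>n. S i \<omega> = (\<Sum>j\<le>i. v j)} *
      jump_prob lattice_adj (Gamma1_conductance lam) (\<Sum>j\<le>n. v j) (\<Sum>j\<le>Suc n. v j)"
      using S unfolding network_walk_def by (elim conjE allE) assumption
    then show ?case
      using Suc by (simp add: jump_prob_Gamma1 N_def measure_pmf_single)
  qed
  note * = indep_vars_of_cylinders[OF rv' N cyl]
  show "indep_vars (\<lambda>_. count_space UNIV) (increment S) UNIV" by (rule *(1))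
  show "distr M (count_space UNIV) (increment S (Suc n)) = measure_pmf (step_pmf lam)"
    using *(2)[of "Suc n"] by (simp add: N_def)
qed

lemma network_walk_steps:
  assumes S: "network_walk M lattice_adj (Gamma1_conductance lam) S"
  shows "prob_space.indep_vars M (\<lambda>_. count_space UNIV) (\<lambda>n \<omega>. S (Suc n) \<omega> - S n \<omega>) UNIV"
    and "distr M (count_space UNIV) (\<lambda>\<omega>. S (Suc n) \<omega> - S n \<omega>) = measure_pmf (step_pmf lam)"
proof -
  interpret prob_space M using S by (simp add: network_walk_def)
  show "indep_vars (\<lambda>_. count_space UNIV) (\<lambda>n \<omega>. S (Suc n) \<omega> - S n \<omega>) UNIV"
    using indep_vars_inj_reindex[OF network_walk_increments(1)[OF S], of Suc UNIV]
    by (simp add: increment_def[abs_def])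
  show "distr M (count_space UNIV) (\<lambda>\<omega>. S (Suc n) \<omega> - S n \<omega>) = measure_pmf (step_pmf lam)"
    using network_walk_increments(2)[OF S, of n] by (simp add: increment_def[abs_def])
qed

section \<open>The difference of two independent walks\<close>

text \<open>Independence between the walks and independence of increments within each make the pairs
  of simultaneous increments an independent family with product laws. The increments of the
  difference are one fixed function of these pairs.\<close>

lemma random_walk_diff_network_walks:
  assumes S: "network_walk M lattice_adj (Gamma1_conductance lam) S"
    and S': "network_walk M lattice_adj (Gamma1_conductance lam) S'"
    and ind: "prob_space.indep_var M
           (Pi\<^sub>M UNIV (\<lambda>_::nat. count_space UNIV)) (\<lambda>\<omega> n. S n \<omega>)
           (Pi\<^sub>M UNIV (\<lambda>_::nat. count_space UNIV)) (\<lambda>\<omega> n. S' n \<omega>)"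
  shows "random_walk M (\<lambda>n \<omega>. S n \<omega> - S' n \<omega>)"
proof -
  interpret prob_space M using S by (simp add: network_walk_def)
  let ?U = "increment S" and ?U' = "increment S'"
  let ?C = "count_space (UNIV :: (int \<times> int) set)"
  define N where "N n = distr M ?C (?U n) \<Otimes>\<^sub>M distr M ?C (?U' n)" for n
  have indU: "indep_vars (\<lambda>_. ?C) ?U UNIV" "indep_vars (\<lambda>_. ?C) ?U' UNIV"
    using network_walk_increments(1) S S' by auto
  have rv: "?U n \<in> measurable M ?C" "?U' n \<in> measurable M ?C" for n
    using indU by (auto simp: indep_vars_def)
  have N: "prob_space (N n)" for n
  proof -
    interpret A: prob_space "distr M ?C (?U n)" by (rule prob_space_distr) (rule rv)
    interpret B: prob_space "distr M ?C (?U' n)" by (rule prob_space_distr) (rule rv)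
    interpret pair_prob_space "distr M ?C (?U n)" "distr M ?C (?U' n)" ..
    show ?thesis unfolding N_def by (rule prob_space_axioms)
  qed
  have setsN: "sets (N n) = UNIV" for n
  proof -
    have "sets (N n) = sets (?C \<Otimes>\<^sub>M ?C)" unfolding N_def by (intro sets_pair_measure_cong) auto
    also have "\<dots> = UNIV" by (subst pair_measure_countable) auto
    finally show ?thesis .
  qed
  have rvp: "(\<lambda>\<omega>. (?U n \<omega>, ?U' n \<omega>)) \<in> measurable M (count_space UNIV)" for n
    by (rule measurable_count_space_binop) (rule rv)+
  have cyl: "prob {\<omega> \<in> space M. \<forall>i\<le>n. (?U i \<omega>, ?U' i \<omega>) = v i} = (\<Prod>i\<le>n. measure (N i) {v i})" for n v
  proof -
    let ?P = "PiM UNIV (\<lambda>_::nat. ?C)"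
    have cylU: "prob {\<omega> \<in> space M. \<forall>i\<le>n. V i \<omega> = w i} = (\<Prod>i\<le>n. measure (distr M ?C (V i)) {w i})"
      if V: "indep_vars (\<lambda>_. ?C) V UNIV" for V w
    proof -
      have r: "V i \<in> measurable M ?C" for i using V by (auto simp: indep_vars_def)
      have "{\<omega> \<in> space M. \<forall>i\<le>n. V i \<omega> = w i} = (\<Inter>i\<in>{..n}. V i -` {w i} \<inter> space M)" by auto
      then have "prob {\<omega> \<in> space M. \<forall>i\<le>n. V i \<omega> = w i} = (\<Prod>i\<le>n. prob (V i -` {w i} \<inter> space M))"
        using indep_varsD[OF V, of "{..n}" "\<lambda>i. {w i}"] by simp
      then show ?thesis using r by (simp add: measure_distr)
    qed
    \<comment> \<open>The hypothesis \<open>ind\<close> concerns whole paths of positions, so the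
      cylinder of increments \<open>w\<close> is written as a set of such paths.\<close>
    define c where "c w = {s \<in> space ?P. \<forall>i\<le>n. s i = (\<Sum>j\<le>i. w j)}" for w :: "nat \<Rightarrow> int \<times> int"
    have c: "c w \<in> sets ?P" for w unfolding c_def by measurable
    have vim: "(\<lambda>\<omega> n. X n \<omega>) -` c w \<inter> space M = {\<omega> \<in> space M. \<forall>i\<le>n. increment X i \<omega> = w i}"
      for X :: "nat \<Rightarrow> 'a \<Rightarrow> int \<times> int" and w
      unfolding increment_eq_iff c_def by (auto simp: space_PiM)
    let ?v = "\<lambda>i. fst (v i)" and ?v' = "\<lambda>i. snd (v i)"
    have "{\<omega> \<in> space M. \<forall>i\<le>n. (?U i \<omega>, ?U' i \<omega>) = v i} =
      ((\<lambda>\<omega> n. S n \<omega>) -` c ?v \<inter> space M) \<inter> ((\<lambda>\<omega> n. S' n \<omega>) -` c ?v' \<inter> space M)"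
      unfolding vim by (auto simp: prod_eq_iff)
    also have "\<dots> = (\<lambda>\<omega>. (\<lambda>n. S n \<omega>, \<lambda>n. S' n \<omega>)) -` (c ?v \<times> c ?v') \<inter> space M" by auto
    also have "prob \<dots> = (\<Prod>i\<le>n. measure (distr M ?C (?U i)) {?v i}) * (\<Prod>i\<le>n. measure (distr M ?C (?U' i)) {?v' i})"
      unfolding indep_varD[OF ind c c] vim cylU[OF indU(1)] cylU[OF indU(2)] ..
    also have "\<dots> = (\<Prod>i\<le>n. measure (N i) {v i})"
    proof (unfold prod.distrib[symmetric], rule prod.cong[OF refl])
      fix i
      interpret A: prob_space "distr M ?C (?U i)" by (rule prob_space_distr) (rule rv)
      interpret B: prob_space "distr M ?C (?U' i)" by (rule prob_space_distr) (rule rv)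
      have "measure (N i) ({?v i} \<times> {?v' i}) = measure (distr M ?C (?U i)) {?v i} * measure (distr M ?C (?U' i)) {?v' i}"
        unfolding N_def measure_def
        by (subst B.emeasure_pair_measure_Times) (auto simp: enn2real_mult)
      then show "measure (distr M ?C (?U i)) {?v i} * measure (distr M ?C (?U' i)) {?v' i} = measure (N i) {v i}"
        by simp
    qed
    finally show ?thesis .
  qed
  note pair = indep_vars_of_cylinders[OF rvp N setsN cyl]
  have inc: "increment (\<lambda>n \<omega>. S n \<omega> - S' n \<omega>) n \<omega> = fst (?U n \<omega>, ?U' n \<omega>) - snd (?U n \<omega>, ?U' n \<omega>)" for n \<omega>
    by (simp add: increment_def split: nat.split)
  have ind_inc: "indep_vars (\<lambda>_. ?C) (increment (\<lambda>n \<omega>. S n \<omega> - S' n \<omega>)) UNIV"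
    unfolding inc[abs_def] by (rule indep_vars_compose2[OF pair(1)]) simp
  have "distr M ?C (increment (\<lambda>n \<omega>. S n \<omega> - S' n \<omega>) (Suc n)) =
    distr (measure_pmf (step_pmf lam) \<Otimes>\<^sub>M measure_pmf (step_pmf lam)) ?C (\<lambda>x. fst x - snd x)" for n
  proof -
    have "distr M ?C (increment (\<lambda>n \<omega>. S n \<omega> - S' n \<omega>) (Suc n)) =
      distr (distr M (count_space UNIV) (\<lambda>\<omega>. (?U (Suc n) \<omega>, ?U' (Suc n) \<omega>))) ?C (\<lambda>x. fst x - snd x)"
      by (subst distr_distr[OF _ rvp]) (simp_all add: o_def inc[abs_def])
    then show ?thesis
      unfolding pair(2) N_def network_walk_increments(2)[OF S] network_walk_increments(2)[OF S'] .
  qed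
  then have "distr M ?C (\<lambda>\<omega>. S (Suc n) \<omega> - S' (Suc n) \<omega> - (S n \<omega> - S' n \<omega>)) =
    distr (measure_pmf (step_pmf lam) \<Otimes>\<^sub>M measure_pmf (step_pmf lam)) ?C (\<lambda>x. fst x - snd x)" for n
    by (simp add: increment_def[abs_def])
  \<comment> \<open>The definition of \<open>random_walk\<close> compares each step with the first
    one; the instance at 0 identifies the law of the first.\<close>
  from this this[of 0] show ?thesis
    using ind_inc prob_space_axioms by (simp add: random_walk_def increment_def[abs_def])
qed

text \<open>The difference is back at its start exactly when the two displacements agree. Mass 1/2
  on at most \<open>49 * n\<close> points gives (1/2)^2 / (49 n) = 1 / (196 n).\<close>

lemma prob_collision_network_walks_ge:
  assumes S: "network_walk M lattice_adj (Gamma1_conductance lam) S"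
    and S': "network_walk M lattice_adj (Gamma1_conductance lam) S'"
    and ind: "prob_space.indep_var M
           (Pi\<^sub>M UNIV (\<lambda>_::nat. count_space UNIV)) (\<lambda>\<omega> n. S n \<omega>)
           (Pi\<^sub>M UNIV (\<lambda>_::nat. count_space UNIV)) (\<lambda>\<omega> n. S' n \<omega>)"
    and n: "n > 0"
  shows "1 / 196 / n \<le> measure M {\<omega> \<in> space M. S n \<omega> - S' n \<omega> = S 0 \<omega> - S' 0 \<omega>}"
proof -
  interpret prob_space M using S by (simp add: network_walk_def)
  let ?C = "count_space (UNIV :: (int \<times> int) set)"
  let ?P = "PiM UNIV (\<lambda>_::nat. ?C)"
  \<comment> \<open>Passing to displacements removes the starting points, whose laws may differ:
    \<open>T S\<close> and \<open>T S'\<close> are the same sum of i.i.d. steps in law.\<close>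
  define T where "T X \<omega> = X n \<omega> - X 0 \<omega>" for X :: "nat \<Rightarrow> 'a \<Rightarrow> int \<times> int" and \<omega>
  have T_sum: "T X \<omega> = (\<Sum>k<n. X (Suc k) \<omega> - X k \<omega>)" for X \<omega>
    unfolding T_def by (rule sum_lessThan_telescope[symmetric])
  have msum: "(\<lambda>y. \<Sum>k<n. y k) \<in> measurable ?P ?C"
    by (intro measurable_count_space_sum measurable_component_singleton) auto
  have distr_T: "distr M ?C (T X) = distr (PiM UNIV (\<lambda>_. measure_pmf (step_pmf lam))) ?C (\<lambda>y. \<Sum>k<n. y k)"
    if X: "network_walk M lattice_adj (Gamma1_conductance lam) X" for X
  proof -
    note st = network_walk_steps[OF X]
    have "X (Suc k) - X k \<in> measurable M ?C" for k
      using st(1) by (auto simp: indep_vars_def fun_diff_def)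
    then have m: "(\<lambda>\<omega> k. X (Suc k) \<omega> - X k \<omega>) \<in> measurable M ?P"
      using measurable_restrict[of UNIV "\<lambda>k \<omega>. X (Suc k) \<omega> - X k \<omega>" M "\<lambda>_. ?C"]
      by (simp add: restrict_UNIV fun_diff_def)
    show ?thesis
      unfolding distr_iid_sequence[OF st, symmetric]
      by (subst distr_distr[OF msum m]) (simp add: o_def T_sum[abs_def])
  qed
  have "(\<lambda>s. s n - s 0) \<in> measurable ?P ?C"
    by (rule measurable_count_space_binop[where h = minus]) (rule measurable_component_singleton, simp)+
  then have "indep_var ?C ((\<lambda>s. s n - s 0) \<circ> (\<lambda>\<omega> n. S n \<omega>)) ?C ((\<lambda>s. s n - s 0) \<circ> (\<lambda>\<omega> n. S' n \<omega>))"
    by (intro indep_var_compose[OF ind])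
  then have ind_T: "indep_var ?C (T S) ?C (T S')"
    by (simp add: o_def T_def[abs_def])
  have bd: "AE \<omega> in M. \<bar>fst (S (Suc i) \<omega> - S i \<omega>)\<bar> \<le> 1 \<and> \<bar>snd (S (Suc i) \<omega> - S i \<omega>)\<bar> \<le> 1" for i
  proof -
    note st = network_walk_steps[OF S]
    have m: "(\<lambda>\<omega>. S (Suc i) \<omega> - S i \<omega>) \<in> measurable M ?C"
      using st(1) by (auto simp: indep_vars_def)
    have "AE v in step_pmf lam. \<bar>fst v\<bar> \<le> 1 \<and> \<bar>snd v\<bar> \<le> 1"
      using set_step_pmf[of lam] by (auto simp: AE_measure_pmf_iff)
    then show ?thesis
      unfolding st(2)[of i, symmetric] by (subst (asm) AE_distr_iff[OF m]) auto
  qed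
  obtain B where B: "finite B" "card B \<le> 49 * real n"
    "prob {\<omega> \<in> space M. (\<Sum>i<n. S (Suc i) \<omega> - S i \<omega>) \<in> B} \<ge> 1/2"
    using sum_in_square[OF network_walk_steps(1)[OF S] bd n] by blast
  define p where "p = prob {\<omega> \<in> space M. T S \<omega> = T S' \<omega>}"
  have "(1/2)\<^sup>2 \<le> (prob {\<omega> \<in> space M. T S \<omega> \<in> B})\<^sup>2"
    using B(3) by (intro power_mono) (auto simp: T_sum)
  also have "\<dots> \<le> card B * p"
    unfolding p_def using distr_T[OF S] distr_T[OF S'] by (intro prob_collision_ge ind_T B) simp
  also have "\<dots> \<le> 49 * real n * p"
    using B(2) by (intro mult_right_mono) (auto simp: p_def)
  finally have "1 / 196 / n \<le> p" using n by (simp add: field_simps power2_eq_square)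
  also have "{\<omega> \<in> space M. T S \<omega> = T S' \<omega>} = {\<omega> \<in> space M. S n \<omega> - S' n \<omega> = S 0 \<omega> - S' 0 \<omega>}"
    by (auto simp: T_def algebra_simps)
  then have "p = measure M {\<omega> \<in> space M. S n \<omega> - S' n \<omega> = S 0 \<omega> - S' 0 \<omega>}"
    by (simp add: p_def)
  finally show ?thesis .
qed

theorem mainTheorem6:
  fixes lam :: real and M :: "'a measure" and S S' :: "nat \<Rightarrow> 'a \<Rightarrow> int \<times> int"
  assumes "lam > 0"
    and "prob_space M"
    and "network_walk M lattice_adj (Gamma1_conductance lam) S"
    and "network_walk M lattice_adj (Gamma1_conductance lam) S'"
    and "prob_space.indep_var M
           (Pi\<^sub>M UNIV (\<lambda>_::nat. count_space UNIV)) (\<lambda>\<omega> n. S n \<omega>)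
           (Pi\<^sub>M UNIV (\<lambda>_::nat. count_space UNIV)) (\<lambda>\<omega> n. S' n \<omega>)"
  shows "recurrent_random_walk M (\<lambda>n \<omega>. S n \<omega> - S' n \<omega>) \<and>
         (AE \<omega> in M. infinite {n. S n \<omega> - S' n \<omega> = S 0 \<omega> - S' 0 \<omega>}) \<and>
         ((AE \<omega> in M. S 0 \<omega> = S' 0 \<omega>) \<longrightarrow> (AE \<omega> in M. infinite {n. S n \<omega> = S' n \<omega>}))"
proof -
  note rw = random_walk_diff_network_walks[OF assms(3-5)]
  have inf: "AE \<omega> in M. infinite {n. S n \<omega> - S' n \<omega> = S 0 \<omega> - S' 0 \<omega>}"
    using prob_collision_network_walks_ge[OF assms(3-5)]
    by (intro AE_infinite_returns[OF rw] not_summable_ge_inverse[where c = "1/196"]) auto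
  have "AE \<omega> in M. \<exists>n>0. S n \<omega> - S' n \<omega> = S 0 \<omega> - S' 0 \<omega>"
    using inf
  proof (rule AE_mp, intro AE_I2 impI)
    fix \<omega> assume "infinite {n. S n \<omega> - S' n \<omega> = S 0 \<omega> - S' 0 \<omega>}"
    then show "\<exists>n>0. S n \<omega> - S' n \<omega> = S 0 \<omega> - S' 0 \<omega>"
      \<comment> \<open>An infinite set of times is unbounded, so it has a member beyond the trivial
        time 0.\<close>
      using infinite_nat_iff_unbounded[THEN iffD1, rule_format, of _ 0] by fastforce
  qed
  with rw have rec: "recurrent_random_walk M (\<lambda>n \<omega>. S n \<omega> - S' n \<omega>)"
    by (simp add: recurrent_random_walk_def)
  have "AE \<omega> in M. infinite {n. S n \<omega> = S' n \<omega>}" if "AE \<omega> in M. S 0 \<omega> = S' 0 \<omega>"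
    using inf that by eventually_elim simp
  with rec inf show ?thesis by blast
qed

end
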